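(* Let $q$ be a complex number with $0<|q|<1$. If $P:=\dfrac{\varphi (q)}{q^{3/4}\psi (q^{6})}$ and $Q:=\dfrac{\varphi (q)}{\varphi(q^{3})}$, then $$(Q^8-6Q^4+8Q^2-3)P^4=256Q^6.$$
   Context: For $|q|<1$, $\varphi(q)=\sum_{m=-\infty}^{\infty}q^{m^2}$ and $\psi(q)=\sum_{m=0}^{\infty}q^{m(m+1)/2}$. Here $q^{3/4}$ means $(q^{1/4})^3$ for any fixed choice of fourth root of $q$ (the positive one if $0<q<1$). *)

theory Defs
  imports "HOL-Analysis.Analysis"
begin

text \<open>
  Ramanujan's theta functions. Both series converge absolutely for \<open>norm q < 1\<close>; outside
  the open unit disc the values are those that \<open>infsum\<close> and \<open>suminf\<close> happen to return
  and carry no meaning. The exponent \<open>m\<^sup>2\<close> is an integer, hence \<open>powi\<close>.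
\<close>

definition ramanujan_phi :: "complex \<Rightarrow> complex" where
  "ramanujan_phi q = (\<Sum>\<^sub>\<infinity>m\<in>(UNIV :: int set). q powi (m\<^sup>2))"

definition ramanujan_psi :: "complex \<Rightarrow> complex" where
  "ramanujan_psi q = (\<Sum>m::nat. q ^ (m * (m + 1) div 2))"

end

theory Submission
  imports Defs
begin

text \<open>
  Write \<open>\<theta>(x, z) = \<Sum> x\<^bsup>n\<^sup>2\<^esup> z\<^bsup>n\<^esup>\<close>. Clearing denominators, the claim is
  \<open>(a\<^sup>2 - b\<^sup>2)\<^bsup>3\<^esup>(a\<^sup>2 + 3b\<^sup>2) = 16q\<^bsup>3\<^esup>t\<^bsup>4\<^esup>a\<^sup>2b\<^sup>2\<close> for \<open>a = \<theta>(q, 1)\<close>, \<open>b = \<theta>(q\<^bsup>3\<^esup>, 1)\<close>,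
  \<open>t = \<theta>(q\<^bsup>3\<^esup>, q\<^bsup>3\<^esup>) = 2\<psi>(q\<^bsup>6\<^esup>)\<close>. With \<open>a' = \<theta>(q, -1)\<close>, \<open>b' = \<theta>(q\<^bsup>3\<^esup>, -1)\<close>, \<open>s = \<theta>(q, q)\<close> it
  follows by elimination from Jacobi's quartic identities for \<open>q\<close> and \<open>q\<^bsup>3\<^esup>\<close>, from the classical
  cubic modular equation \<open>ab = a'b' + qst\<close> (a rotation of the hexagonal lattice), and from
  \<open>b\<^bsup>3\<^esup>s = a(q\<^sup>2t\<^bsup>3\<^esup> + a'b's)\<close>.

  The last identity is about the values \<open>\<theta>(q\<^bsup>3\<^esup>, \<plusminus>q)\<close>, \<open>\<theta>(q\<^bsup>3\<^esup>, \<plusminus>q\<^sup>2)\<close> at 3-torsion points. Rearranging a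
  sum over \<open>\<int>\<^bsup>3\<^esup>\<close> gives \<open>\<theta>(q\<^bsup>3\<^esup>, v) \<theta>(q\<^bsup>3\<^esup>, vq\<^sup>2) \<theta>(q\<^bsup>3\<^esup>, v/q\<^sup>2) = K \<theta>(q, v)\<close> with \<open>K\<close> independent of
  \<open>v\<close>. The remaining multiplier relation, a form of Jacobi's derivative formula, says that a
  certain quotient is 1; the duplication formulas show that this quotient does not change
  under \<open>q \<mapsto> q\<^sup>2\<close>, and it tends to 1 at 0. The same iteration shows that the denominators do not vanish.
\<close>

section \<open>The two-variable theta series and its convergence\<close>

text \<open>Jacobi's theta_3 with nome \<open>x\<close> and z = exp(2iu). At \<open>z = 1\<close>,
  \<open>z = - 1\<close> and \<open>z = x\<close> it is phi(x), phi(-x) and 2 psi(x^2); the last is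
  theta_2 without its factor x^(1/4), so that no fractional powers occur.\<close>

definition theta :: "complex \<Rightarrow> complex \<Rightarrow> complex" where
  "theta x z = (\<Sum>\<^sub>\<infinity>n\<in>(UNIV :: int set). x powi (n\<^sup>2) * z powi n)"

lemma summable_on_int_abs:
  fixes g :: "nat \<Rightarrow> real"
  assumes g: "summable g" and pos: "\<And>k. g k \<ge> 0"
  shows "(\<lambda>n::int. g (nat \<bar>n\<bar>)) summable_on UNIV"
proof -
  have s: "g summable_on UNIV"
    using assms summable_on_UNIV_nonneg_real_iff by blast
  have 1: "(\<lambda>n. g (nat \<bar>n\<bar>)) summable_on range int"
    by (subst summable_on_reindex) (auto simp: o_def s)
  have 2: "(\<lambda>n. g (nat \<bar>n\<bar>)) summable_on range (\<lambda>k. - int k)"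
    by (subst summable_on_reindex) (auto simp: o_def s inj_on_def)
  have "(UNIV :: int set) = range int \<union> range (\<lambda>k. - int k)"
    by (auto simp: image_iff) (metis int_cases2)
  thus ?thesis
    using summable_on_union[OF 1 2] by simp
qed

text \<open>The terms are k-th powers of \<open>r ^ k * c\<close>, which tends to 0, so a geometric
  series of ratio 1/2 dominates eventually.\<close>

lemma summable_gaussian:
  fixes r c :: real
  assumes "0 \<le> r" "r < 1" "0 \<le> c"
  shows "summable (\<lambda>k. r ^ k\<^sup>2 * c ^ k)"
proof (rule summable_comparison_test_ev)
  have "(\<lambda>k. r ^ k * c) \<longlonglongrightarrow> 0 * c"
    by (intro tendsto_intros LIMSEQ_realpow_zero assms)
  hence "eventually (\<lambda>k. r ^ k * c < 1/2) sequentially"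
    by (rule order_tendstoD) auto
  thus "eventually (\<lambda>k. norm (r ^ k\<^sup>2 * c ^ k) \<le> (1/2) ^ k) sequentially"
  proof eventually_elim
    case (elim k)
    have "r ^ k\<^sup>2 * c ^ k = (r ^ k * c) ^ k"
      by (simp add: power_mult_distrib power_mult power2_eq_square)
    also have "\<dots> \<le> (1/2) ^ k"
      using elim assms by (intro power_mono) auto
    finally show ?case using assms by simp
  qed
qed (auto intro!: summable_geometric)

lemma theta_summable:
  fixes x z :: complex
  assumes "0 < norm x" "norm x < 1" "z \<noteq> 0"
  shows "(\<lambda>n::int. x powi (n\<^sup>2) * z powi n) summable_on UNIV"
proof -
  \<comment> \<open>Dominating both |z| and 1/|z| bounds \<open>z powi n\<close> by \<open>c\<close>
    to the power |n| for either sign of n.\<close>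
  define c where "c = max (norm z) (1 / norm z)"
  have c: "c \<ge> norm z" "c \<ge> 1 / norm z" "c \<ge> 0"
    by (auto simp: c_def le_max_iff_disj)
  have le: "norm (z powi n) \<le> c ^ nat \<bar>n\<bar>" for n
  proof (cases "n \<ge> 0")
    case True
    thus ?thesis using c by (auto simp: power_int_def norm_power intro!: power_mono)
  next
    case False
    hence "norm (z powi n) = (1 / norm z) ^ nat \<bar>n\<bar>"
      by (simp add: power_int_def norm_power norm_divide inverse_eq_divide)
    thus ?thesis using c by (auto intro!: power_mono)
  qed
  have sum: "(\<lambda>n::int. norm x ^ (nat \<bar>n\<bar>)\<^sup>2 * c ^ nat \<bar>n\<bar>) summable_on UNIV"
    using assms c by (intro summable_on_int_abs summable_gaussian) auto
  have "norm (x powi (n\<^sup>2) * z powi n) \<le> norm x ^ (nat \<bar>n\<bar>)\<^sup>2 * c ^ nat \<bar>n\<bar>" for n :: int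
  proof -
    have "x powi (n\<^sup>2) = x ^ (nat \<bar>n\<bar>)\<^sup>2"
      by (simp add: power_int_def nat_power_eq flip: nat_power_eq)
    thus ?thesis using le[of n] by (simp add: norm_mult norm_power mult_left_mono)
  qed
  hence "(\<lambda>n::int. norm (x powi (n\<^sup>2) * z powi n)) summable_on UNIV"
    by (intro Infinite_Sum.abs_summable_on_comparison_test'[OF sum])
  thus ?thesis by (rule abs_summable_summable)
qed

text \<open>Summability of complex families is absolute, so the product family is absolutely
  summable and Fubini applies.\<close>

lemma has_sum_Times_complex:
  fixes f :: "'a \<Rightarrow> complex" and g :: "'b \<Rightarrow> complex"
  assumes f: "f summable_on A" and g: "g summable_on B"
  shows "((\<lambda>(i, j). f i * g j) has_sum infsum f A * infsum g B) (A \<times> B)"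
proof -
  have nf: "(\<lambda>i. norm (f i)) summable_on A" and ng: "(\<lambda>j. norm (g j)) summable_on B"
    using f g by (auto simp: summable_on_iff_abs_summable_on_complex)
  have "(\<lambda>(i, j). norm (f i) * norm (g j)) summable_on A \<times> B"
    by (rule summable_on_SigmaI[where g = "\<lambda>i. norm (f i) * infsum (\<lambda>j. norm (g j)) B"])
       (auto intro!: has_sum_cmult_right has_sum_infsum ng summable_on_cmult_left nf)
  hence "(\<lambda>p. norm ((\<lambda>(i, j). f i * g j) p)) summable_on A \<times> B"
    by (simp add: case_prod_unfold norm_mult)
  hence s: "(\<lambda>(i, j). f i * g j) summable_on A \<times> B"
    by (rule abs_summable_summable)
  have "infsum (\<lambda>(i, j). f i * g j) (A \<times> B) = (\<Sum>\<^sub>\<infinity>i\<in>A. \<Sum>\<^sub>\<infinity>j\<in>B. f i * g j)"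
    using infsum_Sigma_banach[OF s] by simp
  also have "\<dots> = infsum f A * infsum g B"
    by (simp add: infsum_cmult_right' infsum_cmult_left')
  finally show ?thesis using has_sum_infsum[OF s] by simp
qed

section \<open>Product and shift formulas\<close>

text \<open>The pairs with even coordinate sum form a sublattice of index two, parametrised by
  \<open>(i + j, i - j)\<close>; the second sum runs over its other coset.\<close>

lemma has_sum_parity_split:
  fixes f :: "int \<times> int \<Rightarrow> complex"
  assumes f: "(f has_sum S) UNIV"
  shows "S = (\<Sum>\<^sub>\<infinity>(i, j)\<in>UNIV. f (i + j, i - j)) + (\<Sum>\<^sub>\<infinity>(i, j)\<in>UNIV. f (i + j + 1, i - j))"
proof -
  define g0 where "g0 = (\<lambda>(i, j). (i + j, i - j :: int))"
  define g1 where "g1 = (\<lambda>(i, j). (i + j + 1, i - j :: int))"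
  have inj: "inj g0" "inj g1" by (auto simp: g0_def g1_def inj_on_def)
  have s: "f summable_on A" for A
    using f has_sum_imp_summable summable_on_subset_banach by blast
  have "range g0 \<inter> range g1 = {}"
    by (auto simp: g0_def g1_def) presburger
  moreover have "range g0 \<union> range g1 = UNIV"
  proof -
    have "(n, m) \<in> range g0 \<union> range g1" for n m
    proof (cases "even (n + m)")
      case True
      then obtain i where "n + m = 2 * i" by blast
      hence "(n, m) = g0 (i, i - m)" by (simp add: g0_def)
      thus ?thesis by blast
    next
      case False
      then obtain i where "n + m = 2 * i + 1" using oddE by blast
      hence "(n, m) = g1 (i, i - m)" by (simp add: g1_def)
      thus ?thesis by blast
    qed
    thus ?thesis by auto
  qed
  ultimately have "S = infsum f (range g0) + infsum f (range g1)"
    using infsum_Un_disjoint[OF s s, of "range g0" "range g1"] f by (simp add: infsumI)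
  thus ?thesis
    using inj by (simp add: infsum_reindex o_def g0_def g1_def case_prod_unfold)
qed

lemma theta_mult_has_sum:
  assumes "0 < norm x" "norm x < 1" "0 < norm y" "norm y < 1" "z \<noteq> 0" "v \<noteq> 0"
  shows "((\<lambda>(n, m). (x powi (n\<^sup>2) * z powi n) * (y powi (m\<^sup>2) * v powi m))
           has_sum theta x z * theta y v) UNIV"
  using has_sum_Times_complex[OF theta_summable theta_summable, of x z y v] assms
  unfolding theta_def by simp

lemma power_int_sq: "(x\<^sup>2) powi k = x powi (2 * k)" for x :: complex
  by (simp add: power_int_mult)

text \<open>In the coordinates of the parity split, n^2 + m^2 becomes 2i^2 + 2j^2 on the even half,
  again diagonal but with nome x^2. On the odd half the extra 2i + 2j + 1 yields the factor
  \<open>x * z\<close> and the shifts by x^2.\<close>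

lemma theta_mult:
  assumes x: "0 < norm x" "norm x < 1" and nz: "z \<noteq> 0" "v \<noteq> 0"
  shows "theta x z * theta x v =
    theta (x\<^sup>2) (z * v) * theta (x\<^sup>2) (z / v) +
    x * z * theta (x\<^sup>2) (x\<^sup>2 * z * v) * theta (x\<^sup>2) (x\<^sup>2 * z / v)"
proof -
  have x0: "x \<noteq> 0" using x by auto
  have x2: "0 < norm (x\<^sup>2)" "norm (x\<^sup>2) < 1"
    using x by (auto simp: norm_power power_less_one_iff)
  define f where "f = (\<lambda>(n, m). (x powi (n\<^sup>2) * z powi n) * (x powi (m\<^sup>2) * v powi m))"
  have f: "(f has_sum theta x z * theta x v) UNIV"
    unfolding f_def using x nz by (intro theta_mult_has_sum)
  have e0: "f (i + j, i - j) = (x\<^sup>2) powi (i\<^sup>2) * (z * v) powi i * ((x\<^sup>2) powi (j\<^sup>2) * (z / v) powi j)" for i j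
  proof -
    have "x powi ((i + j)\<^sup>2) * x powi ((i - j)\<^sup>2) = x powi (2 * i\<^sup>2) * x powi (2 * j\<^sup>2)"
      using x0 by (simp flip: power_int_add) (simp add: power2_eq_square algebra_simps)
    thus ?thesis unfolding f_def power_int_sq
      using nz by (simp add: power_int_add power_int_diff power_int_mult_distrib power_int_divide_distrib field_simps)
  qed
  have e1: "f (i + j + 1, i - j) = x * z * ((x\<^sup>2) powi (i\<^sup>2) * (x\<^sup>2 * z * v) powi i *
       ((x\<^sup>2) powi (j\<^sup>2) * (x\<^sup>2 * z / v) powi j))" for i j
  proof -
    have "x powi ((i + j + 1)\<^sup>2) * x powi ((i - j)\<^sup>2) =
          x powi 1 * (x powi (2 * i\<^sup>2) * x powi (2 * i) * x powi (2 * j\<^sup>2) * x powi (2 * j))"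
      using x0 by (simp flip: power_int_add del: power_int_1_right) (simp add: power2_eq_square algebra_simps)
    thus ?thesis unfolding f_def
      using nz x0 by (simp add: power_int_sq power_int_add power_int_diff power_int_mult_distrib
          power_int_divide_distrib field_simps)
  qed
  have h0: "((\<lambda>(i, j). f (i + j, i - j)) has_sum theta (x\<^sup>2) (z * v) * theta (x\<^sup>2) (z / v)) UNIV"
    unfolding e0 using x2 nz by (intro theta_mult_has_sum) auto
  have h1: "((\<lambda>(i, j). f (i + j + 1, i - j)) has_sum
      x * z * (theta (x\<^sup>2) (x\<^sup>2 * z * v) * theta (x\<^sup>2) (x\<^sup>2 * z / v))) UNIV"
    unfolding e1 case_prod_unfold
    using theta_mult_has_sum[of "x\<^sup>2" "x\<^sup>2" "x\<^sup>2 * z * v" "x\<^sup>2 * z / v"] x2 nz x0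
    by (intro has_sum_cmult_right) (auto simp: case_prod_unfold)
  show ?thesis
    using has_sum_parity_split[OF f] infsumI[OF h0] infsumI[OF h1] by (simp add: mult.assoc)
qed

lemma theta_inverse: "theta x (1 / z) = theta x z"
proof -
  have "theta x z = (\<Sum>\<^sub>\<infinity>n\<in>(UNIV :: int set). x powi ((- n)\<^sup>2) * z powi (- n))"
    unfolding theta_def by (rule infsum_reindex_bij_betw[symmetric]) (auto intro: bij_uminus)
  thus ?thesis
    by (simp add: theta_def power_int_minus power_int_divide_distrib inverse_eq_divide)
qed

text \<open>Quasi-periodicity, from n \<mapsto> n + 1 and (n + 1)^2 = n^2 + 2n + 1.\<close>

lemma theta_shift:
  assumes "x \<noteq> 0" "z \<noteq> 0"
  shows "x * z * theta x (x\<^sup>2 * z) = theta x z"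
proof -
  have "theta x z = (\<Sum>\<^sub>\<infinity>n\<in>(UNIV :: int set). x powi ((n + 1)\<^sup>2) * z powi (n + 1))"
    unfolding theta_def by (rule infsum_reindex_bij_betw[symmetric]) (rule bij_plus_right)
  also have "\<dots> = (\<Sum>\<^sub>\<infinity>n\<in>(UNIV :: int set). x * z * (x powi (n\<^sup>2) * (x\<^sup>2 * z) powi n))"
  proof (rule infsum_cong)
    fix n :: int
    have "x powi ((n + 1)\<^sup>2) = x powi 1 * (x powi (n\<^sup>2) * x powi (2 * n))"
      using assms by (simp flip: power_int_add del: power_int_1_right) (simp add: power2_eq_square algebra_simps)
    thus "x powi ((n + 1)\<^sup>2) * z powi (n + 1) = x * z * (x powi (n\<^sup>2) * (x\<^sup>2 * z) powi n)"
      using assms by (simp add: power_int_sq power_int_add power_int_mult_distrib)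
  qed
  finally show ?thesis by (simp add: theta_def infsum_cmult_right')
qed

lemma ramanujan_phi_eq_theta: "ramanujan_phi q = theta q 1"
  by (simp add: ramanujan_phi_def theta_def)

text \<open>Shift and inversion both relate the values at -1/x and -x, but with opposite
  signs.\<close>

lemma theta_diagonal_neg:
  assumes "x \<noteq> 0"
  shows "theta x (- x) = 0"
proof -
  have "x * (- (1 / x)) * theta x (x\<^sup>2 * (- (1 / x))) = theta x (- (1 / x))"
    using assms by (intro theta_shift) auto
  moreover have "x\<^sup>2 * (- (1 / x)) = - x" using assms by (simp add: power2_eq_square)
  moreover have "theta x (- (1 / x)) = theta x (- x)"
    using theta_inverse[of x "- x"] by simp
  ultimately show ?thesis using assms by simp
qed


section \<open>Duplication formulas and Jacobi's quartic identity\<close>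

text \<open>The odd half of the product formula contains the value at -x^2 for nome x^2, which is a
  zero.\<close>

lemma theta_mult_neg:
  assumes x: "0 < norm x" "norm x < 1" and "z \<noteq> 0"
  shows "theta x z * theta x (- z) = theta (x\<^sup>2) (- 1) * theta (x\<^sup>2) (- (z\<^sup>2))"
proof -
  have "theta (x\<^sup>2) (x\<^sup>2 * z / (- z)) = 0"
    using theta_diagonal_neg[of "x\<^sup>2"] assms by auto
  thus ?thesis
    using theta_mult[OF x, of z "- z"] assms by (simp add: power2_eq_square mult_ac)
qed

lemma theta_square:
  assumes "0 < norm x" "norm x < 1" "z \<noteq> 0"
  shows "(theta x z)\<^sup>2 = theta (x\<^sup>2) (z\<^sup>2) * theta (x\<^sup>2) 1 +
    x * z * theta (x\<^sup>2) (x\<^sup>2 * z\<^sup>2) * theta (x\<^sup>2) (x\<^sup>2)"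
  using theta_mult[of x z z] assms by (simp add: power2_eq_square mult_ac)

lemma theta_diagonal_square:
  assumes "0 < norm x" "norm x < 1"
  shows "(theta x x)\<^sup>2 = 2 * theta (x\<^sup>2) 1 * theta (x\<^sup>2) (x\<^sup>2)"
proof -
  have "x\<^sup>2 * theta (x\<^sup>2) (x\<^sup>2 * x\<^sup>2) = theta (x\<^sup>2) 1"
    using theta_shift[of "x\<^sup>2" 1] assms by (auto simp: power2_eq_square)
  hence "x * x * theta (x\<^sup>2) (x\<^sup>2 * x\<^sup>2) = theta (x\<^sup>2) 1"
    by (simp add: power2_eq_square)
  thus ?thesis
    using theta_square[of x x] assms by auto
qed

text \<open>Duplication expresses all three squares through \<open>f\<close> and \<open>g\<close>,
  and (f^2 + xg^2)^2 - (f^2 - xg^2)^2 = 4xf^2g^2.\<close>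

lemma theta_quartic:
  assumes x: "0 < norm x" "norm x < 1"
  shows "(theta x 1) ^ 4 = (theta x (- 1)) ^ 4 + x * (theta x x) ^ 4"
proof -
  define f where "f = theta (x\<^sup>2) 1"
  define g where "g = theta (x\<^sup>2) (x\<^sup>2)"
  have 1: "(theta x 1)\<^sup>2 = f\<^sup>2 + x * g\<^sup>2"
    using theta_square[OF x, of 1] by (simp add: f_def g_def power2_eq_square)
  have 2: "(theta x (- 1))\<^sup>2 = f\<^sup>2 - x * g\<^sup>2"
    using theta_square[OF x, of "- 1"] by (simp add: f_def g_def power2_eq_square)
  have 3: "(theta x x)\<^sup>2 = 2 * f * g"
    using theta_diagonal_square[OF x] by (simp add: f_def g_def)
  have 4: "u ^ 4 = (u\<^sup>2)\<^sup>2" for u :: complex by simp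
  show ?thesis unfolding 4 1 2 3 by algebra
qed

text \<open>Extends Jacobi's quartic identity, which is the case \<open>z = 1\<close>. Duplication
  turns it into a polynomial identity in four values of nome x^2.\<close>

lemma theta_square_relation:
  assumes x: "0 < norm x" "norm x < 1" and z: "z \<noteq> 0"
  shows "(theta x 1)\<^sup>2 * (theta x z)\<^sup>2 - x * z * (theta x x)\<^sup>2 * (theta x (x * z))\<^sup>2 =
         (theta x (- 1))\<^sup>2 * (theta x (- z))\<^sup>2"
proof -
  define f where "f = theta (x\<^sup>2) 1"
  define g where "g = theta (x\<^sup>2) (x\<^sup>2)"
  define F where "F = theta (x\<^sup>2) (z\<^sup>2)"
  define G where "G = theta (x\<^sup>2) (x\<^sup>2 * z\<^sup>2)"
  have x0: "x \<noteq> 0" using x by auto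
  have 1: "(theta x 1)\<^sup>2 = f\<^sup>2 + x * g\<^sup>2"
    using theta_square[OF x, of 1] by (simp add: f_def g_def power2_eq_square)
  have 2: "(theta x (- 1))\<^sup>2 = f\<^sup>2 - x * g\<^sup>2"
    using theta_square[OF x, of "- 1"] by (simp add: f_def g_def power2_eq_square)
  have 3: "(theta x x)\<^sup>2 = 2 * f * g"
    using theta_diagonal_square[OF x] by (simp add: f_def g_def)
  have 4: "(theta x z)\<^sup>2 = F * f + x * z * G * g"
    using theta_square[OF x z] by (simp add: f_def g_def F_def G_def)
  have 5: "(theta x (- z))\<^sup>2 = F * f - x * z * G * g"
    using theta_square[OF x, of "- z"] z by (simp add: f_def g_def F_def G_def)
  \<comment> \<open>Squaring the value at \<open>x * z\<close> produces one at x^4 z^2; the shift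
    brings it back to \<open>F\<close>.\<close>
  have "x\<^sup>2 * z\<^sup>2 * theta (x\<^sup>2) (x\<^sup>2 * (x * z)\<^sup>2) = F"
    using theta_shift[of "x\<^sup>2" "z\<^sup>2"] x0 z by (simp add: F_def power2_eq_square mult_ac)
  hence 6: "z * (theta x (x * z))\<^sup>2 = z * G * f + F * g"
    using theta_square[OF x, of "x * z"] x0 z
    by (simp add: f_def g_def G_def power_mult_distrib) (simp add: power2_eq_square algebra_simps)
  have "(theta x 1)\<^sup>2 * (theta x z)\<^sup>2 - x * z * (theta x x)\<^sup>2 * (theta x (x * z))\<^sup>2 =
        (f\<^sup>2 + x * g\<^sup>2) * (F * f + x * z * G * g) - x * (2 * f * g) * (z * G * f + F * g)"
    unfolding 1 3 4 6[symmetric] by (simp only: mult_ac)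
  also have "\<dots> = (f\<^sup>2 - x * g\<^sup>2) * (F * f - x * z * G * g)"
    by algebra
  finally show ?thesis by (simp only: 2 5)
qed

section \<open>Lattice sums: the cubic modular equation and a triple product\<close>

lemma theta_hexagonal:
  assumes q: "0 < norm q" "norm q < 1"
  shows "theta q 1 * theta (q ^ 3) 1 =
    theta q (- 1) * theta (q ^ 3) (- 1) + q * theta q q * theta (q ^ 3) (q ^ 3)"
proof -
  have q0: "q \<noteq> 0" using q by auto
  have q3: "0 < norm (q ^ 3)" "norm (q ^ 3) < 1"
    using q by (auto simp: norm_power power_less_one_iff)
  have cube: "(q ^ 3) powi k = q powi (3 * k)" for k
    by (simp add: power_int_mult)
  define f where "f = (\<lambda>(n, m). q powi (n\<^sup>2 + 3 * m\<^sup>2))"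
  define f' where "f' = (\<lambda>(n, m). (- 1) powi (n + m) * q powi (n\<^sup>2 + 3 * m\<^sup>2))"
  \<comment> \<open>The exponent is n^2 + 3m^2 evaluated at (n + 1/2, m + 1/2).\<close>
  define g where "g = (\<lambda>(n, m). q powi (n\<^sup>2 + n + 3 * m\<^sup>2 + 3 * m + 1))"
  have f: "(f has_sum theta q 1 * theta (q ^ 3) 1) UNIV"
    using theta_mult_has_sum[OF q q3, of 1 1] q0
    by (simp add: f_def cube power_int_add)
  have f': "(f' has_sum theta q (- 1) * theta (q ^ 3) (- 1)) UNIV"
    using theta_mult_has_sum[OF q q3, of "- 1" "- 1"] q0
    by (simp add: f'_def cube power_int_add mult_ac)
  have g: "(g has_sum q * (theta q q * theta (q ^ 3) (q ^ 3))) UNIV"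
    using has_sum_cmult_right[OF theta_mult_has_sum[OF q q3, of q "q ^ 3"], of q] q0
    by (simp add: g_def cube power_int_add mult_ac case_prod_unfold)
  have ev: "f' (i + j, i - j) = f (i + j, i - j)" for i j
  proof -
    have "i + j + (i - j) = 2 * i" by simp
    thus ?thesis by (simp only: f_def f'_def prod.case) simp
  qed
  have od: "f' (i + j + 1, i - j) = - f (i + j + 1, i - j)" for i j
  proof -
    have "i + j + 1 + (i - j) = 2 * i + 1" by simp
    thus ?thesis by (simp only: f_def f'_def prod.case power_int_add) simp
  qed
  \<comment> \<open>\<open>f\<close> and \<open>f'\<close> agree on the even half and are opposite
    on the odd half, so their difference is twice the odd half of \<open>f\<close>. Both halves of
    \<open>g\<close> turn out to equal this sum.\<close>
  define S where "S = (\<Sum>\<^sub>\<infinity>(i, j)\<in>UNIV. f (i + j + 1, i - j))"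
  have "theta q 1 * theta (q ^ 3) 1 - theta q (- 1) * theta (q ^ 3) (- 1) = 2 * S"
    unfolding has_sum_parity_split[OF f] has_sum_parity_split[OF f'] ev od
    by (simp add: S_def case_prod_unfold infsum_uminus)
  \<comment> \<open>The witness is an involution preserving the hexagonal form i^2 - ij + j^2; it
    also matches the linear terms.\<close>
  moreover have "(\<Sum>\<^sub>\<infinity>(i, j)\<in>UNIV. g (i + j, i - j)) = S"
    unfolding S_def
    by (rule infsum_reindex_bij_witness[where i = "\<lambda>(k, l). (k, k - l)" and j = "\<lambda>(k, l). (k, k - l)"])
       (auto simp: f_def g_def power2_eq_square algebra_simps)
  \<comment> \<open>In the original coordinates this is n \<mapsto> -1 - n with m fixed, a symmetry
    of \<open>g\<close> that reverses the parity of n + m.\<close>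
  moreover have "(\<Sum>\<^sub>\<infinity>(i, j)\<in>UNIV. g (i + j + 1, i - j)) = (\<Sum>\<^sub>\<infinity>(i, j)\<in>UNIV. g (i + j, i - j))"
    by (rule infsum_reindex_bij_witness[where i = "\<lambda>(k, l). (- l - 1, - k - 1)"
          and j = "\<lambda>(k, l). (- l - 1, - k - 1)"])
       (auto simp: g_def power2_eq_square algebra_simps)
  ultimately have "theta q 1 * theta (q ^ 3) 1 - theta q (- 1) * theta (q ^ 3) (- 1) =
      q * (theta q q * theta (q ^ 3) (q ^ 3))"
    using has_sum_parity_split[OF g] by simp
  thus ?thesis by (simp add: algebra_simps)
qed

text \<open>
  The constant is a sum over a coset of the hexagonal lattice. The map
  \<open>(n\<^sub>1, n\<^sub>2, n\<^sub>3) \<mapsto> (n\<^sub>3, n\<^sub>1, n\<^sub>2 + 1)\<close> raises the coordinate sum by one and acts on the part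
  orthogonal to \<open>(1, 1, 1)\<close> as a rotation, so all fibres of the coordinate sum contribute \<open>K\<close>.
\<close>

lemma theta_cubic:
  assumes q: "0 < norm q" "norm q < 1"
  obtains K where "\<And>v. v \<noteq> 0 \<Longrightarrow>
    theta (q ^ 3) v * theta (q ^ 3) (v * q\<^sup>2) * theta (q ^ 3) (v / q\<^sup>2) = K * theta q v"
proof -
  have q0: "q \<noteq> 0" using q by auto
  have q3: "0 < norm (q ^ 3)" "norm (q ^ 3) < 1"
    using q by (auto simp: norm_power power_less_one_iff)
  have cube: "(q ^ 3) powi k = q powi (3 * k)" for k
    by (simp add: power_int_mult)
  \<comment> \<open>The power of q in the triple product on the fibre n + m + k = N, with n
    eliminated; v contributes only its N-th power there.\<close>
  define G where "G = (\<lambda>N (m, k). q powi (3 * ((N - m - k)\<^sup>2 + m\<^sup>2 + k\<^sup>2) + 2 * m - 2 * k))"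
  define S where "S = (\<lambda>N :: int. infsum (G N) UNIV)"
  have step: "S (N + 1) = q powi (2 * N + 1) * S N" for N
  proof -
    have "S (N + 1) = (\<Sum>\<^sub>\<infinity>p\<in>UNIV. q powi (2 * N + 1) * G N p)"
      unfolding S_def
    proof (rule infsum_reindex_bij_witness[where i = "\<lambda>(m, k). (N - m - k, m + 1)"
          and j = "\<lambda>(m, k). (k - 1, N + 1 - m - k)"])
      fix p :: "int \<times> int"
      obtain m k where p: "p = (m, k)" by (cases p)
      show "(case case p of (m, k) \<Rightarrow> (k - 1, N + 1 - m - k) of (m, k) \<Rightarrow> (N - m - k, m + 1)) = p"
        by (simp add: p)
      show "(case case p of (m, k) \<Rightarrow> (N - m - k, m + 1) of (m, k) \<Rightarrow> (k - 1, N + 1 - m - k)) = p"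
        by (simp add: p)
      show "q powi (2 * N + 1) * G N (case p of (m, k) \<Rightarrow> (k - 1, N + 1 - m - k)) = G (N + 1) p"
        using q0 unfolding p G_def prod.case
        by (simp flip: power_int_add) (simp add: power2_eq_square algebra_simps)
    qed auto
    thus ?thesis by (simp add: S_def infsum_cmult_right')
  qed
  \<comment> \<open>The exponents 2N + 1 telescope to N^2, so the sum over the fibres becomes a
    theta series of nome q.\<close>
  have S: "S N = q powi (N\<^sup>2) * S 0" for N
  proof (induction N rule: int_induct[where k = 0])
    case (step1 i)
    have "q powi ((i + 1)\<^sup>2) = q powi (2 * i + 1) * q powi (i\<^sup>2)"
      using q0 by (simp flip: power_int_add) (simp add: power2_eq_square algebra_simps)
    thus ?case by (simp only: step step1 mult.assoc)
  next
    case (step2 i)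
    have "q powi (i\<^sup>2) = q powi (2 * (i - 1) + 1) * q powi ((i - 1)\<^sup>2)"
      using q0 by (simp flip: power_int_add) (simp add: power2_eq_square algebra_simps)
    hence "q powi (2 * (i - 1) + 1) * S (i - 1) = q powi (2 * (i - 1) + 1) * (q powi ((i - 1)\<^sup>2) * S 0)"
      using step[of "i - 1"] step2 by (auto simp: mult.assoc)
    moreover have "q powi (2 * (i - 1) + 1) \<noteq> 0" using q0 by simp
    ultimately show ?case using mult_left_cancel by blast
  qed simp
  have "theta (q ^ 3) v * theta (q ^ 3) (v * q\<^sup>2) * theta (q ^ 3) (v / q\<^sup>2) = S 0 * theta q v"
    if v: "v \<noteq> 0" for v
  proof -
    define T where "T = theta (q ^ 3) v * (theta (q ^ 3) (v * q\<^sup>2) * theta (q ^ 3) (v / q\<^sup>2))"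
    define h where "h = (\<lambda>(N, m, k). (N - m - k, m, k :: int))"
    define F where "F = (\<lambda>(n, m, k). ((q ^ 3) powi (n\<^sup>2) * v powi n) *
      (((q ^ 3) powi (m\<^sup>2) * (v * q\<^sup>2) powi m) * ((q ^ 3) powi (k\<^sup>2) * (v / q\<^sup>2) powi k)))"
    have p: "((\<lambda>(m, k). ((q ^ 3) powi (m\<^sup>2) * (v * q\<^sup>2) powi m) * ((q ^ 3) powi (k\<^sup>2) * (v / q\<^sup>2) powi k))
        has_sum theta (q ^ 3) (v * q\<^sup>2) * theta (q ^ 3) (v / q\<^sup>2)) UNIV"
      using v q0 by (intro theta_mult_has_sum q3) auto
    have F: "(F has_sum T) UNIV"
      using has_sum_Times_complex[OF theta_summable[OF q3 v] has_sum_imp_summable[OF p]]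
      unfolding infsumI[OF p] by (simp add: F_def T_def theta_def[of _ v] case_prod_unfold)
    have "bij h"
      by (rule bij_betwI[where g = "\<lambda>(n, m, k). (n + m + k, m, k)"]) (auto simp: h_def)
    hence "(F has_sum T) UNIV \<longleftrightarrow> ((\<lambda>p. F (h p)) has_sum T) UNIV"
      by (subst has_sum_reindex_bij_betw) auto
    moreover have "F (h (N, p)) = v powi N * G N p" for N p
    proof -
      obtain m k where p: "p = (m, k)" by (cases p)
      have vq: "(v * q\<^sup>2) powi m = v powi m * q powi (2 * m)"
        by (simp only: power_int_mult_distrib power_int_sq)
      have vq': "(v / q\<^sup>2) powi k = v powi k * q powi (- 2 * k)"
        by (simp add: power_int_divide_distrib power_int_sq power_int_minus field_simps)
      have "F (h (N, p)) = (v powi (N - m - k) * v powi m * v powi k) *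
          (q powi (3 * (N - m - k)\<^sup>2) * q powi (3 * m\<^sup>2) * q powi (2 * m) *
           q powi (3 * k\<^sup>2) * q powi (- 2 * k))"
        unfolding F_def h_def p prod.case cube vq vq' by (simp only: mult_ac)
      also have "v powi (N - m - k) * v powi m * v powi k = v powi N"
        using v by (simp flip: power_int_add)
      also have "q powi (3 * (N - m - k)\<^sup>2) * q powi (3 * m\<^sup>2) * q powi (2 * m) *
           q powi (3 * k\<^sup>2) * q powi (- 2 * k) = G N p"
        using q0 unfolding p G_def prod.case
        by (simp flip: power_int_add) (simp add: algebra_simps)
      finally show ?thesis .
    qed
    hence "(\<lambda>p. F (h p)) = (\<lambda>(N, p). v powi N * G N p)" by auto
    ultimately have hs: "((\<lambda>(N, p). v powi N * G N p) has_sum T) UNIV" using F by simp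
    have "T = (\<Sum>\<^sub>\<infinity>N\<in>UNIV. \<Sum>\<^sub>\<infinity>p\<in>UNIV. v powi N * G N p)"
      using infsum_Sigma_banach[of "\<lambda>(N, p). v powi N * G N p" UNIV "\<lambda>_. UNIV"] hs
      by (simp add: infsumI has_sum_imp_summable)
    also have "\<dots> = (\<Sum>\<^sub>\<infinity>N\<in>UNIV. S 0 * (q powi (N\<^sup>2) * v powi N))"
    proof (rule infsum_cong)
      fix N :: int
      have "(\<Sum>\<^sub>\<infinity>p\<in>UNIV. v powi N * G N p) = v powi N * S N"
        by (simp add: S_def infsum_cmult_right')
      thus "(\<Sum>\<^sub>\<infinity>p\<in>UNIV. v powi N * G N p) = S 0 * (q powi (N\<^sup>2) * v powi N)"
        unfolding S[of N] by (simp only: mult_ac)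
    qed
    also have "\<dots> = S 0 * theta q v" by (simp add: infsum_cmult_right' theta_def)
    finally show ?thesis by (simp add: T_def mult.assoc)
  qed
  thus thesis using that by blast
qed

section \<open>Limits at q = 0 and the link with psi\<close>

text \<open>Only the index \<open>i0\<close> contributes a constant term. For |q| at most 1/2 all
  others together are at most |q| times a constant, finite by summability at 1/2.\<close>

lemma powser_tendsto_1:
  fixes e :: "'i \<Rightarrow> nat" and c :: "'i \<Rightarrow> complex"
  assumes sum: "(\<lambda>i. (1/2 :: real) ^ e i) summable_on UNIV"
    and i0: "e i0 = 0" "c i0 = 1"
    and e: "\<And>i. i \<noteq> i0 \<Longrightarrow> e i \<ge> 1"
    and c: "\<And>i. norm (c i) \<le> 1"
  shows "((\<lambda>q. \<Sum>\<^sub>\<infinity>i. c i * q ^ e i) \<longlongrightarrow> 1) (at 0)"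
proof -
  \<comment> \<open>The factor 2 compensates for the one power of 1/2 lost when |q| is pulled
    out.\<close>
  define S where "S = (\<Sum>\<^sub>\<infinity>i\<in>-{i0}. 2 * (1/2 :: real) ^ e i)"
  have bound: "norm ((\<Sum>\<^sub>\<infinity>i. c i * q ^ e i) - 1) \<le> norm q * S" if q: "norm q \<le> 1/2" for q
  proof -
    have le: "norm (c i * q ^ e i) \<le> norm q ^ e i" for i
      using c[of i] by (simp add: norm_mult norm_power mult_left_le_one_le)
    have le': "norm (c i * q ^ e i) \<le> (1/2) ^ e i" for i
      using le[of i] power_mono[OF q, of "e i"] by simp
    have abs: "(\<lambda>i. norm (c i * q ^ e i)) summable_on UNIV"
      by (intro Infinite_Sum.abs_summable_on_comparison_test'[OF sum] le')
    have s: "(\<lambda>i. c i * q ^ e i) summable_on A" for A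
      using abs_summable_summable[OF abs] summable_on_subset_banach by blast
    have abs': "(\<lambda>i. norm (c i * q ^ e i)) summable_on -{i0}"
      using abs summable_on_subset_banach by blast
    have sum': "(\<lambda>i. norm q * (2 * (1/2 :: real) ^ e i)) summable_on -{i0}"
      by (intro summable_on_cmult_right summable_on_subset_banach[OF sum]) auto
    have "(\<Sum>\<^sub>\<infinity>i. c i * q ^ e i) = (\<Sum>\<^sub>\<infinity>i\<in>{i0}. c i * q ^ e i) + (\<Sum>\<^sub>\<infinity>i\<in>-{i0}. c i * q ^ e i)"
      using infsum_Un_disjoint[OF s s, of "{i0}" "-{i0}"] by simp
    hence "norm ((\<Sum>\<^sub>\<infinity>i. c i * q ^ e i) - 1) = norm (\<Sum>\<^sub>\<infinity>i\<in>-{i0}. c i * q ^ e i)"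
      by (simp add: i0)
    also have "\<dots> \<le> (\<Sum>\<^sub>\<infinity>i\<in>-{i0}. norm (c i * q ^ e i))"
      by (rule norm_infsum_bound[OF abs'])
    also have "\<dots> \<le> (\<Sum>\<^sub>\<infinity>i\<in>-{i0}. norm q * (2 * (1/2) ^ e i))"
    proof (rule infsum_mono[OF abs' sum'])
      fix i assume "i \<in> -{i0}"
      then obtain k where k: "e i = Suc k" using e[of i] by (cases "e i") auto
      have "norm (c i * q ^ e i) \<le> norm q * norm q ^ k" using le[of i] k by simp
      also have "\<dots> \<le> norm q * (1/2) ^ k" by (intro mult_left_mono power_mono q) auto
      finally show "norm (c i * q ^ e i) \<le> norm q * (2 * (1/2) ^ e i)" by (simp add: k)
    qed
    also have "\<dots> = norm q * S" by (simp add: S_def infsum_cmult_right')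
    finally show ?thesis .
  qed
  have "((\<lambda>q. (\<Sum>\<^sub>\<infinity>i. c i * q ^ e i) - 1) \<longlongrightarrow> 0) (at 0)"
  proof (rule Lim_null_comparison)
    have "eventually (\<lambda>q :: complex. norm q < 1/2) (at 0)"
      unfolding eventually_at by (intro exI[of _ "1/2"]) auto
    thus "eventually (\<lambda>q. norm ((\<Sum>\<^sub>\<infinity>i. c i * q ^ e i) - 1) \<le> norm q * S) (at 0)"
      by eventually_elim (rule bound, simp)
    show "((\<lambda>q :: complex. norm q * S) \<longlongrightarrow> 0) (at 0)"
      by (auto intro!: tendsto_eq_intros)
  qed
  thus ?thesis by (simp add: LIM_zero_iff)
qed

text \<open>The condition \<open>j < k\<close> gives kn^2 + jn \<ge> |n|, so the exponents are
  natural numbers vanishing only at n = 0. For j = k the index n = -1 would also give exponent 0,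
  which is why \<open>theta q q\<close> tends to 2.\<close>

lemma theta_tendsto_1:
  fixes k j :: nat and s :: complex
  assumes "j < k" and s: "s = 1 \<or> s = - 1"
  shows "((\<lambda>q. theta (q ^ k) (s * q ^ j)) \<longlongrightarrow> 1) (at 0)"
proof -
  define e where "e = (\<lambda>n::int. nat (int k * n\<^sup>2 + int j * n))"
  have e_ge: "nat \<bar>n\<bar> \<le> e n" and e_pos: "int k * n\<^sup>2 + int j * n \<ge> 0" for n
  proof -
    have "\<bar>n\<bar> * 1 \<le> \<bar>n\<bar> * \<bar>n\<bar>"
    proof (cases "n = 0")
      case False
      thus ?thesis by (intro mult_left_mono) linarith+
    qed simp
    hence "\<bar>n\<bar> \<le> n\<^sup>2" by (simp add: power2_eq_square)
    hence "(int j + 1) * \<bar>n\<bar> \<le> int k * n\<^sup>2" using assms by (intro mult_mono) auto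
    moreover have "int j * (- n) \<le> int j * \<bar>n\<bar>" by (intro mult_left_mono) auto
    ultimately have "\<bar>n\<bar> \<le> int k * n\<^sup>2 + int j * n" by (simp add: algebra_simps)
    thus "nat \<bar>n\<bar> \<le> e n" "int k * n\<^sup>2 + int j * n \<ge> 0" by (auto simp: e_def nat_mono)
  qed
  have "((\<lambda>q. \<Sum>\<^sub>\<infinity>n. s powi n * q ^ e n) \<longlongrightarrow> 1) (at 0)"
  proof (rule powser_tendsto_1[where ?i0.0 = 0])
    have "(\<lambda>n::int. (1/2 :: real) ^ nat \<bar>n\<bar>) summable_on UNIV"
      by (rule summable_on_int_abs) (auto intro: summable_geometric)
    hence "(\<lambda>n. norm ((1/2 :: real) ^ e n)) summable_on UNIV"
      by (rule Infinite_Sum.abs_summable_on_comparison_test') (auto intro!: power_decreasing e_ge)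
    thus "(\<lambda>n. (1/2 :: real) ^ e n) summable_on UNIV" by simp
    show "e n \<ge> 1" if "n \<noteq> 0" for n using e_ge[of n] that by simp
    show "norm (s powi n) \<le> 1" for n using s by (auto simp: norm_power_int)
  qed (auto simp: e_def)
  moreover have "eventually (\<lambda>q. (\<Sum>\<^sub>\<infinity>n. s powi n * q ^ e n) = theta (q ^ k) (s * q ^ j)) (at 0)"
    using eventually_at_ball'[of 1 "0 :: complex" UNIV, simplified]
  proof eventually_elim
    case (elim q)
    have "q ^ e n = q powi (int k * n\<^sup>2 + int j * n)" for n
      using e_pos[of n] by (simp add: e_def power_int_def)
    also have "q powi (int k * n\<^sup>2 + int j * n) = (q ^ k) powi n\<^sup>2 * (q ^ j) powi n" for n
      using elim by (simp add: power_int_add power_int_mult)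
    finally show ?case
      by (simp add: theta_def power_int_mult_distrib mult_ac)
  qed
  ultimately show ?thesis by (rule Lim_transform_eventually)
qed

text \<open>The indices n and -1 - n have the same exponent n^2 + n, so each term with n \<ge> 0
  counts twice.\<close>

lemma theta_diagonal_eq:
  assumes "0 < norm q" "norm q < 1"
  shows "theta q q = 2 * (\<Sum>\<^sub>\<infinity>m::nat. q ^ (m * (m + 1)))"
    and "(\<lambda>m::nat. q ^ (m * (m + 1))) summable_on UNIV"
proof -
  have q0: "q \<noteq> 0" using assms by auto
  define f where "f = (\<lambda>n::int. q powi (n\<^sup>2) * q powi n)"
  have f: "f summable_on A" for A
    using theta_summable[OF assms q0] summable_on_subset_banach unfolding f_def by blast
  have U: "(UNIV :: int set) = range int \<union> range (\<lambda>k. - 1 - int k)"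
  proof -
    have "n \<in> range int \<union> range (\<lambda>k. - 1 - int k)" for n
    proof (cases "n \<ge> 0")
      case False
      hence "n = - 1 - int (nat (- 1 - n))" by simp
      thus ?thesis by blast
    qed (metis UnI1 nonneg_int_cases rangeI)
    thus ?thesis by blast
  qed
  have inj: "inj int" "inj (\<lambda>k. - 1 - int k)" by (auto simp: inj_on_def)
  have 1: "f (int m) = q ^ (m * (m + 1))" for m
  proof -
    have "f (int m) = q powi (int (m * (m + 1)))"
      using q0 by (simp add: f_def power2_eq_square algebra_simps flip: power_int_add)
    thus ?thesis by (simp only: power_int_of_nat)
  qed
  have 2: "f (- 1 - int m) = f (int m)" for m
    using q0 by (simp add: f_def flip: power_int_add) (simp add: power2_eq_square algebra_simps)
  have "theta q q = infsum f (range int) + infsum f (range (\<lambda>k. - 1 - int k))"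
    unfolding theta_def f_def[symmetric] U by (rule infsum_Un_disjoint[OF f f]) auto
  thus "theta q q = 2 * (\<Sum>\<^sub>\<infinity>m::nat. q ^ (m * (m + 1)))"
    using inj by (simp add: infsum_reindex o_def 1 2)
  show "(\<lambda>m::nat. q ^ (m * (m + 1))) summable_on UNIV"
    using f[of "range int"] inj by (simp add: summable_on_reindex o_def 1)
qed

lemma ramanujan_psi_square:
  assumes "0 < norm q" "norm q < 1"
  shows "theta q q = 2 * ramanujan_psi (q\<^sup>2)"
proof -
  have "(q\<^sup>2) ^ (m * (m + 1) div 2) = q ^ (m * (m + 1))" for m
    by (simp flip: power_mult)
  hence "ramanujan_psi (q\<^sup>2) = (\<Sum>m. q ^ (m * (m + 1)))"
    by (simp add: ramanujan_psi_def)
  also have "\<dots> = (\<Sum>\<^sub>\<infinity>m. q ^ (m * (m + 1)))"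
    using has_sum_imp_sums[OF has_sum_infsum[OF theta_diagonal_eq(2)[OF assms]]] sums_unique by metis
  finally show ?thesis by (simp add: theta_diagonal_eq(1)[OF assms])
qed

lemma theta_diagonal_tendsto: "((\<lambda>q. theta q q) \<longlongrightarrow> 2) (at 0)"
proof -
  have "((\<lambda>q::complex. \<Sum>\<^sub>\<infinity>m::nat. 1 * q ^ (m * (m + 1))) \<longlongrightarrow> 1) (at 0)"
  proof (rule powser_tendsto_1[where ?i0.0 = 0])
    have "(\<lambda>m::nat. (1/2 :: real) ^ m) summable_on UNIV"
      by (subst summable_on_UNIV_nonneg_real_iff) (auto intro: summable_geometric)
    hence "(\<lambda>m::nat. norm ((1/2 :: real) ^ (m * (m + 1)))) summable_on UNIV"
      by (rule Infinite_Sum.abs_summable_on_comparison_test') (auto intro!: power_decreasing)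
    thus "(\<lambda>m::nat. (1/2 :: real) ^ (m * (m + 1))) summable_on UNIV" by simp
  qed auto
  hence "((\<lambda>q::complex. 2 * (\<Sum>\<^sub>\<infinity>m::nat. 1 * q ^ (m * (m + 1)))) \<longlongrightarrow> 2 * 1) (at 0)"
    by (intro tendsto_intros)
  moreover have "eventually (\<lambda>q. 2 * (\<Sum>\<^sub>\<infinity>m::nat. 1 * q ^ (m * (m + 1))) = theta q q) (at 0)"
    using eventually_at_ball'[of 1 "0 :: complex" UNIV, simplified]
    by eventually_elim (simp add: theta_diagonal_eq(1))
  ultimately show ?thesis using Lim_transform_eventually by fastforce
qed

section \<open>Iteration of q \<mapsto> q^2 and non-vanishing\<close>

lemma tendsto_iterated_square:
  fixes f :: "complex \<Rightarrow> complex"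
  assumes f: "(f \<longlongrightarrow> L) (at 0)" and q: "0 < norm q" "norm q < 1"
  shows "(\<lambda>k. f (q ^ 2 ^ k)) \<longlonglongrightarrow> L"
proof (rule filterlim_compose[OF f])
  have "(\<lambda>k. q ^ 2 ^ k) \<longlonglongrightarrow> 0"
    by (rule filterlim_compose[OF LIMSEQ_power_zero[OF q(2)]])
       (rule filterlim_subseq, auto simp: strict_mono_def)
  thus "filterlim (\<lambda>k. q ^ 2 ^ k) (at 0) sequentially"
    using q by (auto simp: filterlim_at)
qed

lemma punctured_disc_power:
  fixes q :: complex
  assumes "0 < norm q" "norm q < 1" "n > 0"
  shows "0 < norm (q ^ n)" "norm (q ^ n) < 1"
  using assms by (auto simp: norm_power power_less_one_iff)

text \<open>The function is constant along q, q^2, q^4, ..., which tends to 0 inside the punctured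
  disc.\<close>

lemma square_invariant_eq_limit:
  fixes f :: "complex \<Rightarrow> complex"
  assumes f: "(f \<longlongrightarrow> L) (at 0)" and q: "0 < norm q" "norm q < 1"
    and inv: "\<And>q. 0 < norm q \<Longrightarrow> norm q < 1 \<Longrightarrow> f (q\<^sup>2) = f q"
  shows "f q = L"
proof -
  have "f (q ^ 2 ^ k) = f q" for k
  proof (induction k)
    case (Suc k)
    have "f (q ^ 2 ^ Suc k) = f ((q ^ 2 ^ k)\<^sup>2)" by (simp add: mult.commute flip: power_mult)
    thus ?case using inv[OF punctured_disc_power[OF q]] Suc by simp
  qed simp
  thus ?thesis using tendsto_iterated_square[OF f q] by (simp add: LIMSEQ_const_iff)
qed

text \<open>A zero at q would propagate along q, q^2, q^4, ... and force the limit at 0 to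
  vanish.\<close>

lemma nonzero_if_square_zero:
  fixes f :: "complex \<Rightarrow> complex"
  assumes f: "(f \<longlongrightarrow> L) (at 0)" "L \<noteq> 0" and q: "0 < norm q" "norm q < 1"
    and inv: "\<And>q. 0 < norm q \<Longrightarrow> norm q < 1 \<Longrightarrow> f q = 0 \<Longrightarrow> f (q\<^sup>2) = 0"
  shows "f q \<noteq> 0"
proof
  assume 0: "f q = 0"
  have "f (q ^ 2 ^ k) = 0" for k
  proof (induction k)
    case (Suc k)
    have "f (q ^ 2 ^ Suc k) = f ((q ^ 2 ^ k)\<^sup>2)" by (simp add: mult.commute flip: power_mult)
    thus ?case using inv[OF punctured_disc_power[OF q]] Suc by simp
  qed (simp add: 0)
  thus False using LIMSEQ_unique[OF tendsto_iterated_square[OF f(1) q]] f(2) by simp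
qed

text \<open>The product of the values at 1 and -1 is the square of
  \<open>theta (q\<^sup>2) (- 1)\<close>, so a zero at q passes to q^2.\<close>

lemma theta_minus_one_nonzero:
  assumes q: "0 < norm q" "norm q < 1"
  shows "theta q (- 1) \<noteq> 0"
proof (rule nonzero_if_square_zero[OF _ _ q])
  show "((\<lambda>q. theta q (- 1)) \<longlongrightarrow> 1) (at 0)"
    using theta_tendsto_1[of 0 1 "- 1"] by simp
  show "theta (q\<^sup>2) (- 1) = 0" if "0 < norm q" "norm q < 1" "theta q (- 1) = 0" for q
    using theta_mult_neg[of q 1] that by simp
qed simp

lemma theta_one_nonzero:
  assumes q: "0 < norm q" "norm q < 1"
  shows "theta q 1 \<noteq> 0"
  using theta_mult_neg[OF q, of 1] theta_minus_one_nonzero[OF punctured_disc_power[OF q, of 2]]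
  by auto

lemma theta_diagonal_nonzero:
  assumes q: "0 < norm q" "norm q < 1"
  shows "theta q q \<noteq> 0"
proof (rule nonzero_if_square_zero[OF theta_diagonal_tendsto _ q])
  show "theta (q\<^sup>2) (q\<^sup>2) = 0" if "0 < norm q" "norm q < 1" "theta q q = 0" for q
    using theta_diagonal_square[of q] theta_one_nonzero[OF punctured_disc_power[of q 2]] that by simp
qed simp

lemma theta_cube_mult_neg:
  assumes q: "0 < norm q" "norm q < 1" and "n > 0"
  shows "theta (q ^ 3) (q ^ n) * theta (q ^ 3) (- (q ^ n)) =
    theta ((q\<^sup>2) ^ 3) (- 1) * theta ((q\<^sup>2) ^ 3) (- ((q\<^sup>2) ^ n))"
  using theta_mult_neg[OF punctured_disc_power[OF q, of 3], of "q ^ n"] q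
  by (auto simp: mult.commute simp flip: power_mult)

lemma theta_cube_neg_nonzero:
  assumes q: "0 < norm q" "norm q < 1"
  shows "theta (q ^ 3) (- q) \<noteq> 0"
proof (rule nonzero_if_square_zero[OF _ _ q])
  show "((\<lambda>q. theta (q ^ 3) (- q)) \<longlongrightarrow> 1) (at 0)"
    using theta_tendsto_1[of 1 3 "- 1"] by simp
  show "theta ((q\<^sup>2) ^ 3) (- (q\<^sup>2)) = 0"
    if q: "0 < norm q" "norm q < 1" "theta (q ^ 3) (- q) = 0" for q
  proof -
    have "theta ((q\<^sup>2) ^ 3) (- 1) \<noteq> 0"
      using q(1,2) by (intro theta_minus_one_nonzero punctured_disc_power) auto
    thus ?thesis using theta_cube_mult_neg[OF q(1,2), of 1] q(3) by simp
  qed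
qed simp

section \<open>Values at 3-torsion points and the multiplier relation\<close>

text \<open>The triple product at \<open>v = 1\<close>, \<open>v = - 1\<close> and
  \<open>v = q ^ 3\<close>. There two of the three factors coincide, by inversion in the first two
  cases and, up to a power of q, by the shift in the third.\<close>

lemma theta_cubic_values:
  assumes q: "0 < norm q" "norm q < 1"
  obtains K where "K \<noteq> 0"
    and "theta (q ^ 3) 1 * (theta (q ^ 3) (q\<^sup>2))\<^sup>2 = K * theta q 1"
    and "theta (q ^ 3) (- 1) * (theta (q ^ 3) (- (q\<^sup>2)))\<^sup>2 = K * theta q (- 1)"
    and "theta (q ^ 3) (q ^ 3) * (theta (q ^ 3) q)\<^sup>2 = K * theta q q"
proof -
  have q0: "q \<noteq> 0" using q by auto
  note q2 = punctured_disc_power[OF q, of 2, OF zero_less_numeral]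
  note q3 = punctured_disc_power[OF q, of 3, OF zero_less_numeral]
  note q6 = punctured_disc_power[OF q2, of 3, OF zero_less_numeral]
  obtain K where K: "\<And>v. v \<noteq> 0 \<Longrightarrow>
      theta (q ^ 3) v * theta (q ^ 3) (v * q\<^sup>2) * theta (q ^ 3) (v / q\<^sup>2) = K * theta q v"
    using theta_cubic[OF q] by metis
  have 1: "theta (q ^ 3) 1 * (theta (q ^ 3) (q\<^sup>2))\<^sup>2 = K * theta q 1"
    using K[of 1] theta_inverse[of "q ^ 3" "q\<^sup>2"] by (simp add: power2_eq_square mult.assoc)
  have 2: "theta (q ^ 3) (- 1) * (theta (q ^ 3) (- (q\<^sup>2)))\<^sup>2 = K * theta q (- 1)"
    using K[of "- 1"] theta_inverse[of "q ^ 3" "- (q\<^sup>2)"]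
    by (simp add: power2_eq_square mult.assoc)
  have "q ^ 3 * (1 / q) * theta (q ^ 3) ((q ^ 3)\<^sup>2 * (1 / q)) = theta (q ^ 3) (1 / q)"
    using q0 by (intro theta_shift) auto
  moreover have "q ^ 3 * (1 / q) = q\<^sup>2" "(q ^ 3)\<^sup>2 * (1 / q) = q ^ 3 * q\<^sup>2"
    using q0 by (simp_all add: field_simps power2_eq_square power3_eq_cube)
  ultimately have 3: "q\<^sup>2 * theta (q ^ 3) (q ^ 3 * q\<^sup>2) = theta (q ^ 3) q"
    by (simp only: theta_inverse)
  have 4: "q\<^sup>2 * theta q (q ^ 3) = theta q q"
    using theta_shift[of q q] q0 by (simp add: power2_eq_square power3_eq_cube mult_ac)
  have "q ^ 3 / q\<^sup>2 = q" using q0 by (simp add: power2_eq_square power3_eq_cube)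
  hence "theta (q ^ 3) (q ^ 3) * theta (q ^ 3) (q ^ 3 * q\<^sup>2) * theta (q ^ 3) q = K * theta q (q ^ 3)"
    using K[of "q ^ 3"] q0 by simp
  hence "theta (q ^ 3) (q ^ 3) * (q\<^sup>2 * theta (q ^ 3) (q ^ 3 * q\<^sup>2)) * theta (q ^ 3) q =
      K * (q\<^sup>2 * theta q (q ^ 3))"
    by (simp add: mult_ac)
  hence 5: "theta (q ^ 3) (q ^ 3) * (theta (q ^ 3) q)\<^sup>2 = K * theta q q"
    unfolding 3 4 by (simp add: power2_eq_square mult_ac)
  have "theta (q ^ 3) q \<noteq> 0"
    using theta_cube_mult_neg[OF q, of 1] theta_minus_one_nonzero[OF q6] theta_cube_neg_nonzero[OF q2]
    by auto
  hence "K \<noteq> 0" using 5 theta_diagonal_nonzero[OF q3] by auto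
  thus thesis using that 1 2 5 by blast
qed

text \<open>The value at \<open>- q\<close> is absent from \<open>theta_cubic_values\<close>; this
  relation ties it to the value at q^2.\<close>

lemma theta_multiplier:
  assumes q: "0 < norm q" "norm q < 1"
  shows "(theta (q ^ 3) (q\<^sup>2))\<^sup>2 * theta q (- 1) * theta q q =
    theta (q ^ 3) (- 1) * theta (q ^ 3) (q ^ 3) * (theta (q ^ 3) (- q))\<^sup>2"
proof -
  define f where "f = (\<lambda>q. ((theta (q ^ 3) (q\<^sup>2))\<^sup>2 * theta q (- 1) * theta q q) /
    (theta (q ^ 3) (- 1) * theta (q ^ 3) (q ^ 3) * (theta (q ^ 3) (- q))\<^sup>2))"
  have lim3: "((\<lambda>q::complex. theta (q ^ 3) (q ^ 3)) \<longlongrightarrow> 2) (at 0)"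
    by (rule filterlim_compose[OF theta_diagonal_tendsto])
       (auto simp: filterlim_at eventually_at_filter intro!: tendsto_eq_intros)
  have "(f \<longlongrightarrow> (1\<^sup>2 * 1 * 2) / (1 * 2 * 1\<^sup>2)) (at 0)"
    unfolding f_def
    using theta_tendsto_1[of 2 3 1] theta_tendsto_1[of 0 1 "- 1"] theta_tendsto_1[of 0 3 "- 1"]
      theta_tendsto_1[of 1 3 "- 1"]
    by (intro tendsto_intros lim3 theta_diagonal_tendsto) auto
  hence lim: "(f \<longlongrightarrow> 1) (at 0)" by simp
  have inv: "f (q\<^sup>2) = f q" if q: "0 < norm q" "norm q < 1" for q
  proof -
    note q2 = punctured_disc_power[OF q, of 2, OF zero_less_numeral]
    note q3 = punctured_disc_power[OF q, of 3, OF zero_less_numeral]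
    note q6 = punctured_disc_power[OF q2, of 3, OF zero_less_numeral]
    have c: "(q ^ 3)\<^sup>2 = (q\<^sup>2) ^ 3" by (simp flip: power_mult)
    define a where "a = theta q 1"
    define a' where "a' = theta q (- 1)"
    define s where "s = theta q q"
    define b where "b = theta (q ^ 3) 1"
    define b' where "b' = theta (q ^ 3) (- 1)"
    define t where "t = theta (q ^ 3) (q ^ 3)"
    define w where "w = theta (q ^ 3) (q\<^sup>2)"
    define z where "z = theta (q ^ 3) (- (q\<^sup>2))"
    define y where "y = theta (q ^ 3) q"
    define X where "X = theta (q ^ 3) (- q)"
    \<comment> \<open>The suffix 2 marks the same function evaluated at q^2 in place of q.\<close>
    define a2 where "a2 = theta (q\<^sup>2) 1"
    define a2' where "a2' = theta (q\<^sup>2) (- 1)"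
    define s2 where "s2 = theta (q\<^sup>2) (q\<^sup>2)"
    define b2 where "b2 = theta ((q\<^sup>2) ^ 3) 1"
    define b2' where "b2' = theta ((q\<^sup>2) ^ 3) (- 1)"
    define t2 where "t2 = theta ((q\<^sup>2) ^ 3) ((q\<^sup>2) ^ 3)"
    define w2 where "w2 = theta ((q\<^sup>2) ^ 3) ((q\<^sup>2)\<^sup>2)"
    define z2 where "z2 = theta ((q\<^sup>2) ^ 3) (- ((q\<^sup>2)\<^sup>2))"
    define X2 where "X2 = theta ((q\<^sup>2) ^ 3) (- (q\<^sup>2))"
    note defs = a_def a'_def s_def b_def b'_def t_def w_def z_def y_def X_def
      a2_def a2'_def s2_def b2_def b2'_def t2_def w2_def z2_def X2_def
    have nz: "a \<noteq> 0" "a' \<noteq> 0" "s \<noteq> 0" "b \<noteq> 0" "b' \<noteq> 0" "t \<noteq> 0" "X \<noteq> 0"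
      "a2 \<noteq> 0" "a2' \<noteq> 0" "s2 \<noteq> 0" "b2 \<noteq> 0" "b2' \<noteq> 0" "t2 \<noteq> 0" "X2 \<noteq> 0"
      unfolding defs
      by (fact theta_one_nonzero[OF q] theta_minus_one_nonzero[OF q] theta_diagonal_nonzero[OF q]
        theta_one_nonzero[OF q3] theta_minus_one_nonzero[OF q3] theta_diagonal_nonzero[OF q3]
        theta_one_nonzero[OF q2] theta_minus_one_nonzero[OF q2] theta_diagonal_nonzero[OF q2]
        theta_one_nonzero[OF q6] theta_minus_one_nonzero[OF q6] theta_diagonal_nonzero[OF q6]
        theta_cube_neg_nonzero[OF q] theta_cube_neg_nonzero[OF q2])+
    obtain K where K: "K \<noteq> 0" "b * w\<^sup>2 = K * a" "b' * z\<^sup>2 = K * a'" "t * y\<^sup>2 = K * s"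
      using theta_cubic_values[OF q] unfolding defs by metis
    obtain K2 where K2: "b2 * w2\<^sup>2 = K2 * a2" "b2' * z2\<^sup>2 = K2 * a2'"
      using theta_cubic_values[OF q2] unfolding defs by metis
    have e1: "a * a' = a2'\<^sup>2" and e2: "b * b' = b2'\<^sup>2"
      using theta_mult_neg[OF q, of 1] theta_mult_neg[OF q3, of 1] unfolding defs c
      by (simp_all add: power2_eq_square)
    have e3: "w * z = b2' * z2" and e4: "y * X = b2' * X2"
      using theta_cube_mult_neg[OF q, of 2] theta_cube_mult_neg[OF q, of 1] unfolding defs by simp_all
    have e5: "s\<^sup>2 = 2 * a2 * s2" and e6: "t\<^sup>2 = 2 * b2 * t2"
      using theta_diagonal_square[OF q] theta_diagonal_square[OF q3] unfolding defs c by simp_all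
    \<comment> \<open>Multiplying the relations at 1 and -1 lets the product formulas pass to q^2,
      where the cubic relations hold with \<open>K2\<close>.\<close>
    have K_sq: "K\<^sup>2 * a2' = b2' ^ 3 * K2"
    proof -
      have "K\<^sup>2 * a2' * a2' = (K * a) * (K * a')"
        using e1 by (simp add: power2_eq_square mult_ac)
      also have "\<dots> = (b * b') * (w * z)\<^sup>2"
        unfolding K(2,3)[symmetric] by (simp add: power2_eq_square mult_ac)
      also have "\<dots> = b2' ^ 3 * (b2' * z2\<^sup>2)"
        unfolding e2 e3 by (simp add: power2_eq_square power3_eq_cube mult_ac)
      also have "\<dots> = b2' ^ 3 * K2 * a2'" unfolding K2 by simp
      finally show ?thesis using nz by simp
    qed
    have X_sq: "X\<^sup>2 * (K * s) = b2'\<^sup>2 * X2\<^sup>2 * t"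
    proof -
      have "X\<^sup>2 * (K * s) = (y * X)\<^sup>2 * t"
        unfolding K(4)[symmetric] by (simp add: power2_eq_square mult_ac)
      thus ?thesis unfolding e4 by (simp add: power2_eq_square mult_ac)
    qed
    have "f q = K * (a * a') * s / ((b * b') * t * X\<^sup>2)"
    proof -
      have "w\<^sup>2 = K * a / b" using K(2) nz by (simp add: field_simps)
      thus ?thesis using nz by (simp add: f_def mult_ac flip: defs)
    qed
    \<comment> \<open>Expanding by \<open>K * s\<close> creates exactly the combinations that
      \<open>K_sq\<close>, \<open>X_sq\<close>, \<open>e5\<close> and \<open>e6\<close> carry over
      to q^2.\<close>
    also have "\<dots> = K\<^sup>2 * a2'\<^sup>2 * s\<^sup>2 / (b2'\<^sup>2 * t * (X\<^sup>2 * (K * s)))"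
      unfolding e1 e2 using nz K(1) by (simp add: power2_eq_square mult_ac)
    also have "\<dots> = (K\<^sup>2 * a2') * a2' * s\<^sup>2 / (b2' ^ 4 * t\<^sup>2 * X2\<^sup>2)"
      unfolding X_sq by (simp add: power2_eq_square power4_eq_xxxx mult_ac)
    also have "\<dots> = K2 * a2 * a2' * s2 / (b2 * b2' * t2 * X2\<^sup>2)"
      unfolding K_sq e5 e6 using nz by (simp add: power3_eq_cube power4_eq_xxxx mult_ac)
    also have "\<dots> = f (q\<^sup>2)"
    proof -
      have "f (q\<^sup>2) = w2\<^sup>2 * a2' * s2 / (b2' * t2 * X2\<^sup>2)" by (simp only: f_def defs)
      also have "w2\<^sup>2 = K2 * a2 / b2" using K2(1) nz by (simp add: field_simps)
      finally show ?thesis by (simp add: mult_ac)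
    qed
    finally show ?thesis by simp
  qed
  have "f q = 1"
    using square_invariant_eq_limit[of f 1 q] lim q inv by blast
  thus ?thesis by (simp add: f_def divide_eq_1_iff)
qed

text \<open>\<open>theta_square_relation\<close> for nome q^3 at \<open>z = q\<close>, multiplied by
  \<open>b * t\<close>: the cubic values replace \<open>y\<^sup>2\<close> and
  \<open>w\<^sup>2\<close>, the multiplier relation replaces \<open>X\<^sup>2\<close>, and
  \<open>K\<close> cancels.\<close>

lemma theta_cube_relation:
  assumes q: "0 < norm q" "norm q < 1"
  shows "(theta (q ^ 3) 1) ^ 3 * theta q q =
    theta q 1 * (q\<^sup>2 * (theta (q ^ 3) (q ^ 3)) ^ 3 + theta q (- 1) * theta (q ^ 3) (- 1) * theta q q)"
proof -
  have q0: "q \<noteq> 0" using q by auto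
  note q3 = punctured_disc_power[OF q, of 3, OF zero_less_numeral]
  define a where "a = theta q 1"
  define a' where "a' = theta q (- 1)"
  define s where "s = theta q q"
  define b where "b = theta (q ^ 3) 1"
  define b' where "b' = theta (q ^ 3) (- 1)"
  define t where "t = theta (q ^ 3) (q ^ 3)"
  define w where "w = theta (q ^ 3) (q\<^sup>2)"
  define y where "y = theta (q ^ 3) q"
  define X where "X = theta (q ^ 3) (- q)"
  note defs = a_def a'_def s_def b_def b'_def t_def w_def y_def X_def
  obtain K where K: "K \<noteq> 0" "b * w\<^sup>2 = K * a" "t * y\<^sup>2 = K * s"
    using theta_cubic_values[OF q] unfolding defs by metis
  have R: "w\<^sup>2 * a' * s = b' * t * X\<^sup>2"
    using theta_multiplier[OF q] by (simp add: defs)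
  have "q ^ 3 * (1 / q\<^sup>2) * theta (q ^ 3) ((q ^ 3)\<^sup>2 * (1 / q\<^sup>2)) = theta (q ^ 3) (1 / q\<^sup>2)"
    using q0 by (intro theta_shift) auto
  moreover have "q ^ 3 * (1 / q\<^sup>2) = q" "(q ^ 3)\<^sup>2 * (1 / q\<^sup>2) = q ^ 3 * q"
    using q0 by (simp_all add: field_simps power2_eq_square power3_eq_cube)
  ultimately have "q * theta (q ^ 3) (q ^ 3 * q) = w"
    by (simp only: theta_inverse w_def)
  hence "w\<^sup>2 = q\<^sup>2 * (theta (q ^ 3) (q ^ 3 * q))\<^sup>2"
    by (simp flip: power_mult_distrib)
  hence S: "b\<^sup>2 * y\<^sup>2 - q\<^sup>2 * t\<^sup>2 * w\<^sup>2 = b'\<^sup>2 * X\<^sup>2"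
    using theta_square_relation[OF q3 q0]
    by (simp add: defs power2_eq_square power3_eq_cube mult_ac)
  have "K * (b ^ 3 * s) = b ^ 3 * (K * s)" by simp
  also have "\<dots> = b * t * (b\<^sup>2 * y\<^sup>2)"
    unfolding K(3)[symmetric] by (simp add: power2_eq_square power3_eq_cube mult_ac)
  also have "b\<^sup>2 * y\<^sup>2 = q\<^sup>2 * t\<^sup>2 * w\<^sup>2 + b'\<^sup>2 * X\<^sup>2" using S by (simp add: algebra_simps)
  also have "b * t * (q\<^sup>2 * t\<^sup>2 * w\<^sup>2 + b'\<^sup>2 * X\<^sup>2) =
      (b * w\<^sup>2) * (q\<^sup>2 * t ^ 3) + b * b' * (b' * t * X\<^sup>2)"
    by (simp add: power2_eq_square power3_eq_cube algebra_simps)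
  also have "\<dots> = (b * w\<^sup>2) * (q\<^sup>2 * t ^ 3 + a' * b' * s)"
    unfolding R[symmetric] by (simp add: algebra_simps)
  also have "\<dots> = K * (a * (q\<^sup>2 * t ^ 3 + a' * b' * s))"
    unfolding K(2) by simp
  finally have "b ^ 3 * s = a * (q\<^sup>2 * t ^ 3 + a' * b' * s)"
    using K(1) by simp
  thus ?thesis by (simp add: defs)
qed

section \<open>Elimination and the modular equation\<close>

lemma cubic_modular_elimination:
  fixes a a' b b' s t q :: complex
  assumes nz: "a \<noteq> 0" "a' \<noteq> 0" "b \<noteq> 0" "b' \<noteq> 0" "s \<noteq> 0" "t \<noteq> 0" "q \<noteq> 0"
    and h1: "a ^ 4 = a' ^ 4 + q * s ^ 4"
    and h2: "b ^ 4 = b' ^ 4 + q ^ 3 * t ^ 4"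
    and h3: "a * b = a' * b' + q * s * t"
    and h4: "b ^ 3 * s = a * (q\<^sup>2 * t ^ 3 + a' * b' * s)"
  shows "(a\<^sup>2 - b\<^sup>2) ^ 3 * (a\<^sup>2 + 3 * b\<^sup>2) = 16 * q ^ 3 * t ^ 4 * a\<^sup>2 * b\<^sup>2"
proof -
  define p where "p = a * b"
  define p' where "p' = a' * b'"
  define r where "r = q * s * t"
  \<comment> \<open>\<open>T\<close> and \<open>M\<close> are chosen so that T r = q^3 t^4 and M p =
    b^4; the hypotheses then make p - p' = r and M - p' = T linear, and b'^4 becomes N p'.\<close>
  define T where "T = q\<^sup>2 * t ^ 3 / s"
  define M where "M = b ^ 3 / a"
  define N where "N = T + p"
  have p: "p = p' + r" using h3 by (simp add: p_def p'_def r_def)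
  have M: "M = T + p'" using h4 nz by (simp add: M_def T_def p'_def field_simps)
  have Tr: "T * r = q ^ 3 * t ^ 4"
    using nz by (simp add: T_def r_def field_simps power2_eq_square power3_eq_cube power4_eq_xxxx)
  have Mp: "M * p = b ^ 4"
    using nz by (simp add: M_def p_def field_simps power3_eq_cube power4_eq_xxxx)
  have aM: "a ^ 4 * M = p ^ 3"
    using nz by (simp add: M_def p_def field_simps power3_eq_cube power4_eq_xxxx)
  have sT: "q * s ^ 4 * T = r ^ 3"
    using nz by (simp add: T_def r_def field_simps power2_eq_square power3_eq_cube power4_eq_xxxx)
  have nz': "p \<noteq> 0" "p' \<noteq> 0" "r \<noteq> 0" "T \<noteq> 0" "M \<noteq> 0"
    using nz by (simp_all add: p_def p'_def r_def T_def M_def)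
  have "b' ^ 4 = M * p - T * r" unfolding Mp Tr using h2 by simp
  also have "\<dots> = N * p'" unfolding M N_def p by (simp add: algebra_simps)
  finally have "a' ^ 4 * (N * p') = p' ^ 4" by (simp add: p'_def power_mult_distrib)
  hence aN: "a' ^ 4 * N = p' ^ 3" using nz' by (simp add: power3_eq_cube power4_eq_xxxx mult.assoc)
  \<comment> \<open>The quartic identity for q, multiplied by M N T, involves only p, p', r and T,
    and leaves a quadratic equation for T.\<close>
  have "p ^ 3 * N * T = (a ^ 4 * M) * N * T" unfolding aM ..
  also have "\<dots> = (a' ^ 4 * N) * M * T + (q * s ^ 4 * T) * M * N"
    unfolding h1 by (simp add: algebra_simps)
  also have "\<dots> = p' ^ 3 * M * T + r ^ 3 * M * N" unfolding aN sT ..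
  finally have "p * p' * r * (3 * T\<^sup>2 + 2 * (p + p') * T - r\<^sup>2) = 0"
    unfolding M N_def p by algebra
  hence quad: "3 * T\<^sup>2 + 2 * (p + p') * T - r\<^sup>2 = 0" using nz' by simp
  have "M * (a\<^sup>2 - b\<^sup>2)\<^sup>2 = a ^ 4 * M + M * b ^ 4 - 2 * M * p\<^sup>2"
    unfolding p_def by algebra
  also have "\<dots> = p * (p - M)\<^sup>2" unfolding aM Mp[symmetric] by algebra
  \<comment> \<open>As p - M = r - T and M = T + p', this is the quadratic equation
    rearranged.\<close>
  also have "(p - M)\<^sup>2 = M * (4 * T)" using quad unfolding M p by algebra
  finally have I: "(a\<^sup>2 - b\<^sup>2)\<^sup>2 = 4 * p * T" using nz' by (simp add: mult_ac)
  \<comment> \<open>Uses a^2 + 3b^2 = (a^2 - b^2) + 4b^2 and b^2(a^2 - b^2) = p^2 - b^4.\<close>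
  have "(a\<^sup>2 - b\<^sup>2) ^ 3 * (a\<^sup>2 + 3 * b\<^sup>2) =
      ((a\<^sup>2 - b\<^sup>2)\<^sup>2)\<^sup>2 + 4 * (a\<^sup>2 - b\<^sup>2)\<^sup>2 * (p\<^sup>2 - b ^ 4)"
    unfolding p_def by algebra
  also have "\<dots> = 16 * p\<^sup>2 * T * (T + p - M)"
    unfolding I Mp[symmetric] by algebra
  also have "T + p - M = r" unfolding M p by simp
  also have "16 * p\<^sup>2 * T * r = 16 * p\<^sup>2 * (T * r)" by (simp add: mult_ac)
  also have "\<dots> = 16 * q ^ 3 * t ^ 4 * a\<^sup>2 * b\<^sup>2"
    unfolding Tr p_def by (simp add: power_mult_distrib mult_ac)
  finally show ?thesis .
qed

theorem theorem3p1:
  fixes q r P Q :: complex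
  assumes "0 < norm q" and "norm q < 1"
    and "r ^ 4 = q"
    and "P = ramanujan_phi q / (r ^ 3 * ramanujan_psi (q ^ 6))"
    and "Q = ramanujan_phi q / ramanujan_phi (q ^ 3)"
  shows "(Q ^ 8 - 6 * Q ^ 4 + 8 * Q\<^sup>2 - 3) * P ^ 4 = 256 * Q ^ 6"
proof -
  note q = assms(1,2)
  have q0: "q \<noteq> 0" using q by auto
  note q3 = punctured_disc_power[OF q, of 3, OF zero_less_numeral]
  define a where "a = theta q 1"
  define b where "b = theta (q ^ 3) 1"
  define c where "c = ramanujan_psi (q ^ 6)"
  have t: "theta (q ^ 3) (q ^ 3) = 2 * c"
    using ramanujan_psi_square[OF q3] by (simp add: c_def flip: power_mult)
  have nz: "a \<noteq> 0" "b \<noteq> 0" "c \<noteq> 0"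
    using theta_one_nonzero[OF q] theta_one_nonzero[OF q3] theta_diagonal_nonzero[OF q3] t
    by (auto simp: a_def b_def)
  have "(a\<^sup>2 - b\<^sup>2) ^ 3 * (a\<^sup>2 + 3 * b\<^sup>2) = 16 * q ^ 3 * (2 * c) ^ 4 * a\<^sup>2 * b\<^sup>2"
    unfolding a_def b_def t[symmetric]
    by (rule cubic_modular_elimination[OF theta_one_nonzero[OF q] theta_minus_one_nonzero[OF q]
        theta_one_nonzero[OF q3] theta_minus_one_nonzero[OF q3] theta_diagonal_nonzero[OF q]
        theta_diagonal_nonzero[OF q3] q0 theta_quartic[OF q] theta_quartic[OF q3]
        theta_hexagonal[OF q] theta_cube_relation[OF q]])
  hence id: "(a\<^sup>2 - b\<^sup>2) ^ 3 * (a\<^sup>2 + 3 * b\<^sup>2) = 256 * q ^ 3 * c ^ 4 * a\<^sup>2 * b\<^sup>2"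
    by (simp add: power_mult_distrib)
  \<comment> \<open>The root \<open>r\<close> enters only through r^12, so any choice of fourth root
    gives the same P^4.\<close>
  have r12: "r ^ 12 = q ^ 3"
    unfolding assms(3)[symmetric] by (simp flip: power_mult)
  have Q: "Q = a / b" by (simp add: assms(5) ramanujan_phi_eq_theta a_def b_def)
  have P: "P ^ 4 = a ^ 4 / (q ^ 3 * c ^ 4)"
    by (simp add: assms(4) ramanujan_phi_eq_theta power_divide power_mult_distrib r12
        flip: a_def c_def)
  \<comment> \<open>This factorisation exposes the homogeneous form of \<open>id\<close> after
    division by b^8.\<close>
  have "Q ^ 8 - 6 * Q ^ 4 + 8 * Q\<^sup>2 - 3 = (Q\<^sup>2 - 1) ^ 3 * (Q\<^sup>2 + 3)"
    by algebra
  also have "Q\<^sup>2 - 1 = (a\<^sup>2 - b\<^sup>2) / b\<^sup>2"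
    using nz by (simp add: Q field_simps)
  also have "Q\<^sup>2 + 3 = (a\<^sup>2 + 3 * b\<^sup>2) / b\<^sup>2"
    using nz by (simp add: Q field_simps)
  also have "((a\<^sup>2 - b\<^sup>2) / b\<^sup>2) ^ 3 * ((a\<^sup>2 + 3 * b\<^sup>2) / b\<^sup>2) =
      ((a\<^sup>2 - b\<^sup>2) ^ 3 * (a\<^sup>2 + 3 * b\<^sup>2)) / b ^ 8"
    by (simp add: power_divide flip: power_mult power_add)
  also have "\<dots> = 256 * q ^ 3 * c ^ 4 * a\<^sup>2 / b ^ 6"
    unfolding id using nz by (simp add: field_simps flip: power_add)
  finally have "(Q ^ 8 - 6 * Q ^ 4 + 8 * Q\<^sup>2 - 3) * P ^ 4 =
      256 * q ^ 3 * c ^ 4 * a\<^sup>2 / b ^ 6 * (a ^ 4 / (q ^ 3 * c ^ 4))"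
    unfolding P by simp
  also have "\<dots> = 256 * Q ^ 6"
    using nz q0 by (simp add: Q power_divide field_simps flip: power_add)
  finally show ?thesis .
qed

end
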